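(* Let $n\geq 10$ and let $C\subseteq\mathbb{F}^n$ be a locating-dominating code. After applying Rule 1 to the shares, every codeword $\mathbf{c}\in C$ has share $s(\mathbf{c})\leq \frac{n}{2}+1$.
   Context: $\mathbb{F}^n$ is the binary Hamming space: the set of binary words of length $n$ with the Hamming distance $d$; two words are adjacent if they are at distance $1$. $N(\mathbf{u})$ is the set of words at distance $1$ from $\mathbf{u}$ and $N[\mathbf{u}]=N(\mathbf{u})\cup\{\mathbf{u}\}$. A code is a nonempty subset $C\subseteq\mathbb{F}^n$; $I(\mathbf{u})=C\cap N[\mathbf{u}]$. $C$ is locating-dominating if $I(\mathbf{u})\neq\emptyset$ for all words $\mathbf{u}$ and $I(\mathbf{u})\neq I(\mathbf{v})$ for all distinct non-codewords $\mathbf{u},\mathbf{v}$. The (initial) share of a codeword $\mathbf{c}$ is $s(\mathbf{c})=\sum_{\mathbf{v}\in N[\mathbf{c}]}1/|I(\mathbf{v})|$. A father is a word $\mathbf{u}$ with $|I(\mathbf{u})|\geq 3$. A son is a word $\mathbf{x}$ with $|I(\mathbf{x})|=2$ and $I(\mathbf{x})\subseteq I(\mathbf{u})$ for some father $\mathbf{u}$. An orphan is a non-codeword $\mathbf{x}$ with $|I(\mathbf{x})|=1$. A codeword $\mathbf{c}$ is special if $I(\mathbf{c})=\{\mathbf{c}\}$, $N(\mathbf{c})$ contains exactly one orphan and exactly $n-2$ sons. A special father is a father adjacent to some special codeword. For a special father $\mathbf{u}$, let $C'(\mathbf{u})$ be the set of codewords $\mathbf{c}'\in I(\mathbf{u})$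 such that $\mathbf{u}$ is the only special father in $N[\mathbf{c}']$ (these sets are pairwise disjoint for distinct special fathers). Rule 1: for every special father $\mathbf{u}$, the share of each codeword in $C'(\mathbf{u})$ is replaced by the average $\frac{1}{|C'(\mathbf{u})|}\sum_{\mathbf{a}\in C'(\mathbf{u})}s(\mathbf{a})$; codewords lying in no set $C'(\mathbf{u})$ keep their share. *)

theory Defs
  imports Complex_Main "HOL-Library.Cardinality"
begin

text \<open>
  A binary word of length \<open>n\<close> is a function \<open>'n \<Rightarrow> bool\<close> on a finite index type
  with \<open>CARD('n) = n\<close>, so the whole Hamming space is the universe of this type.
\<close>

type_synonym 'n bword = "'n \<Rightarrow> bool"

definition hamming_dist :: "'n::finite bword \<Rightarrow> 'n bword \<Rightarrow> nat" where
  "hamming_dist u v = card {i. u i \<noteq> v i}"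

definition nbhd :: "'n::finite bword \<Rightarrow> 'n bword set" where
  "nbhd u = {v. hamming_dist u v = 1}"

definition closed_nbhd :: "'n::finite bword \<Rightarrow> 'n bword set" where
  "closed_nbhd u = nbhd u \<union> {u}"

definition I_set :: "'n::finite bword set \<Rightarrow> 'n bword \<Rightarrow> 'n bword set" where
  "I_set C u = C \<inter> closed_nbhd u"

definition locating_dominating :: "'n::finite bword set \<Rightarrow> bool" where
  "locating_dominating C \<longleftrightarrow>
     C \<noteq> {} \<and>
     (\<forall>u. I_set C u \<noteq> {}) \<and>
     (\<forall>u v. u \<notin> C \<longrightarrow> v \<notin> C \<longrightarrow> u \<noteq> v \<longrightarrow> I_set C u \<noteq> I_set C v)"

definition share :: "'n::finite bword set \<Rightarrow> 'n bword \<Rightarrow> real" where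
  "share C c = (\<Sum>v\<in>closed_nbhd c. 1 / real (card (I_set C v)))"

definition father :: "'n::finite bword set \<Rightarrow> 'n bword \<Rightarrow> bool" where
  "father C u \<longleftrightarrow> card (I_set C u) \<ge> 3"

definition son :: "'n::finite bword set \<Rightarrow> 'n bword \<Rightarrow> bool" where
  "son C x \<longleftrightarrow> card (I_set C x) = 2 \<and> (\<exists>u. father C u \<and> I_set C x \<subseteq> I_set C u)"

definition orphan :: "'n::finite bword set \<Rightarrow> 'n bword \<Rightarrow> bool" where
  "orphan C x \<longleftrightarrow> x \<notin> C \<and> card (I_set C x) = 1"

definition special_codeword :: "'n::finite bword set \<Rightarrow> 'n bword \<Rightarrow> bool" where
  "special_codeword C c \<longleftrightarrow>
     c \<in> C \<and> I_set C c = {c} \<and>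
     card {x \<in> nbhd c. orphan C x} = 1 \<and>
     card {x \<in> nbhd c. son C x} = CARD('n) - 2"

definition special_father :: "'n::finite bword set \<Rightarrow> 'n bword \<Rightarrow> bool" where
  "special_father C u \<longleftrightarrow> father C u \<and> (\<exists>c. special_codeword C c \<and> u \<in> nbhd c)"

definition C' :: "'n::finite bword set \<Rightarrow> 'n bword \<Rightarrow> 'n bword set" where
  "C' C u = {c' \<in> I_set C u. {w \<in> closed_nbhd c'. special_father C w} = {u}}"

lemma C'_disjoint: "u \<noteq> v \<Longrightarrow> C' C u \<inter> C' C v = {}"
  by (auto simp: C'_def)

text \<open>
  By disjointness of the sets \<open>C' C u\<close>, the description in the first branch is
  well defined; all averages are taken over the initial shares.
\<close>

definition share_rule1 :: "'n::finite bword set \<Rightarrow> 'n bword \<Rightarrow> real" where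
  "share_rule1 C c =
     (if \<exists>u. special_father C u \<and> c \<in> C' C u
      then let u = (THE u. special_father C u \<and> c \<in> C' C u)
           in (\<Sum>a\<in>C' C u. share C a) / real (card (C' C u))
      else share C c)"

lemma share_rule1_average:
  assumes "special_father C u" "c \<in> C' C u"
  shows "share_rule1 C c = (\<Sum>a\<in>C' C u. share C a) / real (card (C' C u))"
proof -
  have "(THE w. special_father C w \<and> c \<in> C' C w) = u"
    using assms C'_disjoint by (intro the_equality) blast+
  then show ?thesis
    using assms unfolding share_rule1_def Let_def by auto
qed

lemma share_rule1_unchanged:
  assumes "\<And>u. special_father C u \<Longrightarrow> c \<notin> C' C u"
  shows "share_rule1 C c = share C c"
  using assms by (auto simp: share_rule1_def)

end

theory Submission
  imports Defs
begin

text \<open>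
  In \<open>N[c]\<close> only \<open>c\<close> itself and at most one orphan can contribute 1 to the share of \<open>c\<close>, so the
  bound can fail only if \<open>I(c) = {c}\<close> and there is an orphan. Then a neighbour \<open>x\<close> with
  \<open>I(x) = {c, c'}\<close> forces the second common neighbour of \<open>c\<close> and \<open>c'\<close> to be a father, so the
  fathers \<open>u\<close> around \<open>c\<close> together see codewords in all directions but that of the orphan, and the
  sum of the \<open>|I(u)|\<close> is at least \<open>n - 1\<close>. For \<open>n \<ge> 10\<close> two or more fathers lower the share
  sufficiently, and with a single father \<open>u\<close> the codeword is special, its excess is \<open>1/|I(u)|\<close>, and
  all neighbours of \<open>u\<close> but one are codewords. The exceptional neighbour is dominated by a codeword
  adjacent to some \<open>a \<in> C'(u)\<close>; the share of \<open>a\<close> is smaller than the bound by at least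
  \<open>1 - 1/|I(u)|\<close>, which pays for all the other codewords in \<open>C'(u)\<close>.
\<close>

subsection \<open>Reciprocals and means\<close>

lemma inverse_le_half: "2 \<le> k \<Longrightarrow> 1 / real k \<le> 1 / 2"
  by (simp add: field_simps)

lemma inverse_le_one: "1 / real k \<le> 1"
  by (cases "k = 0") (auto simp: field_simps)

lemma sum_inverse_le_half_card:
  fixes f :: "'a \<Rightarrow> real"
  assumes card_ge_2: "2 \<le> card A" and ge_3: "\<And>a. a \<in> A \<Longrightarrow> 3 \<le> f a" and sum_ge_9: "9 \<le> sum f A"
  shows "(\<Sum>a\<in>A. 1 / f a) \<le> (real (card A) - 1) / 2"
proof (cases "card A = 2")
  case True
  then obtain a b where A: "A = {a, b}" "a \<noteq> b"
    by (auto simp: card_2_iff)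
  have bounds: "3 \<le> f a" "3 \<le> f b" "9 \<le> f a + f b"
    using ge_3 sum_ge_9 A by auto
  \<comment> \<open>\<open>(x - 2)(y - 2) - 4 = (x - 3)(y - 3) + (x + y - 9)\<close>, and \<open>1/x + 1/y \<le> 1/2\<close>
    amounts to \<open>(x - 2)(y - 2) \<ge> 4\<close>.\<close>
  have "0 \<le> (f a - 3) * (f b - 3)"
    using bounds by simp
  then have "2 * (f a + f b) \<le> f a * f b"
    using bounds by (simp add: algebra_simps)
  then have "1 / f a + 1 / f b \<le> 1 / 2"
    using bounds by (simp add: field_simps)
  then show ?thesis
    using A by simp
next
  case False
  have "1 / f a \<le> 1 / 3" if "a \<in> A" for a
    using ge_3[OF that] by (simp add: field_simps)
  then have "(\<Sum>a\<in>A. 1 / f a) \<le> real (card A) * (1 / 3)"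
    by (rule sum_bounded_above)
  also have "\<dots> \<le> (real (card A) - 1) / 2"
    using card_ge_2 False by simp
  finally show ?thesis .
qed

lemma mean_le_if_compensated:
  fixes f :: "'a \<Rightarrow> real"
  assumes "finite A" "b \<in> A" and excess: "\<And>a. a \<in> A \<Longrightarrow> f a \<le> B + e"
    and deficit: "f b \<le> B + e - d" and compensated: "real (card A) * e \<le> d"
  shows "sum f A / real (card A) \<le> B"
proof -
  have card_eq: "real (card A) = 1 + real (card (A - {b}))"
    using card.remove[OF assms(1,2)] by simp
  have "sum f A = f b + sum f (A - {b})"
    using assms(1,2) by (rule sum.remove)
  also have "sum f (A - {b}) \<le> real (card (A - {b})) * (B + e)"
    using excess by (intro sum_bounded_above) simp
  also have "f b + \<dots> \<le> real (card A) * (B + e) - d"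
    using deficit by (simp add: card_eq algebra_simps)
  also have "\<dots> \<le> real (card A) * B"
    using compensated by (simp add: algebra_simps)
  finally show ?thesis
    using card_eq by (simp add: divide_le_eq mult.commute)
qed

subsection \<open>Neighbourhoods by directions\<close>

definition flip :: "'n bword \<Rightarrow> 'n \<Rightarrow> 'n bword" where
  "flip u i = u(i := \<not> u i)"

lemma flip_flip [simp]: "flip (flip u i) i = u"
  by (simp add: flip_def)

lemma flip_commute: "flip (flip u i) j = flip (flip u j) i"
  by (auto simp: flip_def fun_eq_iff)

lemma flip_neq [simp]: "flip u i \<noteq> u" "u \<noteq> flip u i"
  by (auto simp: flip_def fun_eq_iff)

lemma flip_eq_iff [simp]: "flip u i = flip u j \<longleftrightarrow> i = j"
  by (auto simp: flip_def fun_eq_iff)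

lemma flip_flip_eq_iff [simp]:
  "flip (flip u i) j = u \<longleftrightarrow> i = j" "u = flip (flip u i) j \<longleftrightarrow> i = j"
  by (auto simp: flip_def fun_eq_iff)

lemma inj_on_flip [simp]: "inj_on (flip u) A"
  by (simp add: inj_on_def)

lemma nbhd_eq_range_flip: "nbhd u = range (flip u)"
proof (intro equalityI subsetI)
  fix v assume "v \<in> nbhd u"
  then obtain i where i: "{j. u j \<noteq> v j} = {i}"
    by (auto simp: nbhd_def hamming_dist_def card_1_singleton_iff)
  have "v j = flip u i j" for j
    using i by (cases "j = i") (auto simp: flip_def)
  then show "v \<in> range (flip u)"
    by auto
next
  fix v assume "v \<in> range (flip u)"
  then obtain i where "v = flip u i" by blast
  then have "{j. u j \<noteq> v j} = {i}"
    by (auto simp: flip_def)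
  then show "v \<in> nbhd u"
    by (simp add: nbhd_def hamming_dist_def)
qed

lemma closed_nbhd_eq_insert_flip: "closed_nbhd u = insert u (range (flip u))"
  by (simp add: closed_nbhd_def nbhd_eq_range_flip)

lemma card_nbhd_Collect: "card {x \<in> nbhd u. P x} = card {i. P (flip u i)}"
proof -
  have "{x \<in> nbhd u. P x} = flip u ` {i. P (flip u i)}"
    by (auto simp: nbhd_eq_range_flip)
  then show ?thesis
    by (simp add: card_image)
qed

definition codeword_dirs :: "'n::finite bword set \<Rightarrow> 'n bword \<Rightarrow> 'n set" where
  "codeword_dirs C u = {i. flip u i \<in> C}"

definition orphan_dirs :: "'n::finite bword set \<Rightarrow> 'n bword \<Rightarrow> 'n set" where
  "orphan_dirs C u = {i. orphan C (flip u i)}"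

definition father_dirs :: "'n::finite bword set \<Rightarrow> 'n bword \<Rightarrow> 'n set" where
  "father_dirs C u = {i. father C (flip u i)}"

definition son_dirs :: "'n::finite bword set \<Rightarrow> 'n bword \<Rightarrow> 'n set" where
  "son_dirs C u = {i. son C (flip u i)}"

abbreviation I_card :: "'n::finite bword set \<Rightarrow> 'n bword \<Rightarrow> nat" where
  "I_card C u \<equiv> card (I_set C u)"

lemma I_set_eq: "I_set C u = (if u \<in> C then {u} else {}) \<union> flip u ` codeword_dirs C u"
  by (auto simp: I_set_def closed_nbhd_eq_insert_flip codeword_dirs_def)

lemma mem_I_set_self [simp]: "u \<in> I_set C u \<longleftrightarrow> u \<in> C"
  by (simp add: I_set_def closed_nbhd_def)

lemma flip_mem_I_set [simp]: "flip u i \<in> I_set C u \<longleftrightarrow> flip u i \<in> C"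
  by (simp add: I_set_def closed_nbhd_eq_insert_flip)

lemma mem_I_set_flip [simp]: "u \<in> I_set C (flip u i) \<longleftrightarrow> u \<in> C"
  using flip_mem_I_set[of "flip u i" i C] by simp

lemma flip_mem_I_set_flip_flip [simp]: "flip u j \<in> I_set C (flip (flip u i) j) \<longleftrightarrow> flip u j \<in> C"
  by (subst flip_commute) simp

lemma I_card_notin: "u \<notin> C \<Longrightarrow> I_card C u = card (codeword_dirs C u)"
  by (simp add: I_set_eq card_image)

lemma I_set_eq_singleton: "I_card C u = 1 \<Longrightarrow> c \<in> I_set C u \<Longrightarrow> I_set C u = {c}"
  by (auto simp: card_1_singleton_iff)

lemma I_card_ge_2: "a \<in> I_set C u \<Longrightarrow> b \<in> I_set C u \<Longrightarrow> a \<noteq> b \<Longrightarrow> 2 \<le> I_card C u"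
  using card_mono[of "I_set C u" "{a, b}"] by simp

lemma fatherI:
  assumes "{a, b, d} \<subseteq> I_set C u" "a \<noteq> b" "a \<noteq> d" "b \<noteq> d"
  shows "father C u"
  using card_mono[OF _ assms(1)] assms(2-) by (simp add: father_def)

lemma disjoint_dirs:
  "orphan_dirs C u \<inter> father_dirs C u = {}"
  "(orphan_dirs C u \<union> father_dirs C u) \<inter> son_dirs C u = {}"
  by (auto simp: orphan_dirs_def father_dirs_def son_dirs_def orphan_def father_def son_def)

lemma orphan_flip_I_set: "c \<in> C \<Longrightarrow> orphan C (flip c i) \<Longrightarrow> I_set C (flip c i) = {c}"
  by (intro I_set_eq_singleton) (simp_all add: orphan_def)

lemma orphan_flip_iff:
  assumes "c \<in> C"
  shows "orphan C (flip c i) \<longleftrightarrow> I_card C (flip c i) = 1"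
proof -
  have "2 \<le> I_card C (flip c i)" if "flip c i \<in> C"
    using that assms by (intro I_card_ge_2[of c _ _ "flip c i"]) simp_all
  then show ?thesis
    by (auto simp: orphan_def)
qed

lemma special_codeword_iff_dirs:
  fixes C :: "'n::finite bword set"
  shows "special_codeword C c \<longleftrightarrow> c \<in> C \<and> I_set C c = {c} \<and>
    card (orphan_dirs C c) = 1 \<and> card (son_dirs C c) = CARD('n) - 2"
  by (simp add: special_codeword_def card_nbhd_Collect orphan_dirs_def son_dirs_def)

lemma special_father_codewordE:
  assumes "special_father C u"
  obtains i where "special_codeword C (flip u i)"
proof -
  obtain c i where "special_codeword C c" "u = flip c i"
    using assms by (auto simp: special_father_def nbhd_eq_range_flip)
  then show thesis
    using that[of i] by simp
qed

lemma special_father_flip_iff: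
  "special_codeword C c \<Longrightarrow> special_father C (flip c i) \<longleftrightarrow> father C (flip c i)"
  by (auto simp: special_father_def nbhd_eq_range_flip)

lemma mem_C'_flipI:
  assumes "c \<in> C" "\<not> special_father C c" "\<And>k. special_father C (flip c k) \<longleftrightarrow> k = i"
  shows "c \<in> C' C (flip c i)"
  using assms by (auto simp: C'_def closed_nbhd_eq_insert_flip)

lemma share_eq_sum_flip:
  "share C c = 1 / real (I_card C c) + (\<Sum>i\<in>UNIV. 1 / real (I_card C (flip c i)))"
proof -
  have "c \<notin> range (flip c)"
    by auto
  then show ?thesis
    by (simp add: share_def closed_nbhd_eq_insert_flip sum.reindex)
qed

lemma share_le_if_other_I_cards_ge_2:
  fixes C :: "'n::finite bword set"
  assumes "\<And>k. k \<noteq> i \<Longrightarrow> 2 \<le> I_card C (flip c k)"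
  shows "share C c \<le>
    1 / real (I_card C c) + 1 / real (I_card C (flip c i)) + (real CARD('n) - 1) / 2"
proof -
  have "(\<Sum>k\<in>UNIV - {i}. 1 / real (I_card C (flip c k))) \<le> real (card (UNIV - {i})) * (1 / 2)"
    using assms by (intro sum_bounded_above inverse_le_half) auto
  also have "\<dots> = (real CARD('n) - 1) / 2"
    by (simp add: card_Diff_singleton of_nat_diff Suc_leI)
  finally show ?thesis
    by (simp add: share_eq_sum_flip sum.remove[of UNIV i])
qed

subsection \<open>Codewords with a large share\<close>

locale locating_dominating_code =
  fixes C :: "'n::finite bword set"
  assumes locating_dominating: "locating_dominating C"
begin

lemma I_set_nonempty: "I_set C u \<noteq> {}"
  using locating_dominating by (simp add: locating_dominating_def)

lemma I_set_inj: "u \<notin> C \<Longrightarrow> v \<notin> C \<Longrightarrow> I_set C u = I_set C v \<Longrightarrow> u = v"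
  using locating_dominating by (auto simp: locating_dominating_def)

lemma I_card_pos: "0 < I_card C u"
  by (simp add: card_gt_0_iff I_set_nonempty)

lemma I_card_ge_2_if_not_orphan:
  assumes "c \<in> C" "\<not> orphan C (flip c i)"
  shows "2 \<le> I_card C (flip c i)"
  using assms I_card_pos[of "flip c i"] by (simp add: orphan_flip_iff)

lemma orphan_flip_unique:
  assumes "c \<in> C" "orphan C (flip c i)" "orphan C (flip c j)"
  shows "i = j"
proof -
  have "I_set C (flip c i) = I_set C (flip c j)"
    using assms by (simp add: orphan_flip_I_set)
  then have "flip c i = flip c j"
    using assms(2,3) by (intro I_set_inj) (simp_all add: orphan_def)
  then show ?thesis
    by simp
qed

lemma share_le_if_no_orphan:
  assumes "c \<in> C" "\<And>i. \<not> orphan C (flip c i)"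
  shows "share C c \<le> real CARD('n) / 2 + 1"
proof -
  fix i :: 'n
  have ge_2: "2 \<le> I_card C (flip c k)" for k
    using assms by (rule I_card_ge_2_if_not_orphan)
  show ?thesis
    using share_le_if_other_I_cards_ge_2[of i C c, OF ge_2] inverse_le_one[of "I_card C c"]
      inverse_le_half[OF ge_2[of i]]
    by (simp add: diff_divide_distrib)
qed

lemma share_le_if_not_isolated:
  assumes "c \<in> C" "I_set C c \<noteq> {c}"
  shows "share C c \<le> real CARD('n) / 2 + 1"
proof (cases "\<exists>i. orphan C (flip c i)")
  case True
  then obtain i where i: "orphan C (flip c i)" by blast
  have "2 \<le> I_card C c"
    using assms I_card_pos[of c] I_set_eq_singleton[of C c c] by fastforce
  then have "1 / real (I_card C c) \<le> 1 / 2"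
    by (rule inverse_le_half)
  moreover have "share C c \<le>
      1 / real (I_card C c) + 1 / real (I_card C (flip c i)) + (real CARD('n) - 1) / 2"
    using orphan_flip_unique[OF assms(1) i] assms(1)
    by (intro share_le_if_other_I_cards_ge_2 I_card_ge_2_if_not_orphan) auto
  ultimately show ?thesis
    using inverse_le_one[of "I_card C (flip c i)"] by (simp add: diff_divide_distrib)
qed (use assms(1) share_le_if_no_orphan in blast)

text \<open>
  The second common neighbour of the two codewords around a word \<open>x\<close> with \<open>|I(x)| = 2\<close> sees both of
  them, and hence, \<open>I\<close> being injective on non-codewords, a third codeword.
\<close>

lemma I_set_psubset_opposite:
  assumes "c \<in> C" "flip c i \<notin> C" "flip c j \<notin> C" "I_card C (flip c i) = 2"
    and "j \<noteq> i" "j \<in> codeword_dirs C (flip c i)"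
  shows "I_set C (flip c i) \<subset> I_set C (flip c j)"
proof -
  let ?d = "flip (flip c i) j"
  have d: "?d \<in> C" "?d \<noteq> c"
    using assms(5,6) by (auto simp: codeword_dirs_def)
  have "{c, ?d} = I_set C (flip c i)"
    using assms(1,4) d by (intro card_seteq) auto
  moreover have "{c, ?d} \<subseteq> I_set C (flip c j)"
    using assms(1) d by (simp add: flip_commute[of c i j])
  moreover have "I_set C (flip c i) \<noteq> I_set C (flip c j)"
    using I_set_inj assms(2,3,5) by fastforce
  ultimately show ?thesis
    by blast
qed

end

locale isolated_codeword = locating_dominating_code C for C :: "'n::finite bword set" +
  fixes c :: "'n bword"
  assumes codeword: "c \<in> C" and isolated: "I_set C c = {c}"
begin

lemma flip_notin: "flip c i \<notin> C"
  using isolated flip_mem_I_set[of c i C] by simp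

lemma I_card_flip: "I_card C (flip c i) = card (codeword_dirs C (flip c i))"
  by (simp add: I_card_notin flip_notin)

lemma obtain_father_if_I_card_2:
  assumes "I_card C (flip c i) = 2"
  obtains j where "father C (flip c j)" "I_set C (flip c i) \<subseteq> I_set C (flip c j)"
    "i \<in> codeword_dirs C (flip c j)"
proof -
  have "card (codeword_dirs C (flip c i)) = 2"
    using assms by (simp add: I_card_flip)
  then have "\<not> codeword_dirs C (flip c i) \<subseteq> {i}"
    using card_mono[of "{i}" "codeword_dirs C (flip c i)"] by auto
  then obtain j where j: "j \<noteq> i" "j \<in> codeword_dirs C (flip c i)"
    by blast
  have psubset: "I_set C (flip c i) \<subset> I_set C (flip c j)"
    using codeword flip_notin flip_notin assms j by (rule I_set_psubset_opposite)
  then have "I_card C (flip c i) < I_card C (flip c j)"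
    by (intro psubset_card_mono) simp_all
  then have "father C (flip c j)"
    using assms by (simp add: father_def)
  then show thesis
    using that j(2) psubset by (auto simp: codeword_dirs_def flip_commute[of c i j])
qed

lemma mem_son_dirs_iff: "i \<in> son_dirs C c \<longleftrightarrow> I_card C (flip c i) = 2"
proof
  assume "I_card C (flip c i) = 2"
  moreover from this obtain j
    where "father C (flip c j)" "I_set C (flip c i) \<subseteq> I_set C (flip c j)"
    by (rule obtain_father_if_I_card_2)
  ultimately show "i \<in> son_dirs C c"
    unfolding son_dirs_def son_def by blast
qed (simp add: son_dirs_def son_def)

lemma UNIV_eq_dirs: "UNIV = orphan_dirs C c \<union> father_dirs C c \<union> son_dirs C c"
proof -
  have "i \<in> orphan_dirs C c \<union> father_dirs C c \<union> son_dirs C c" for i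
    using I_card_pos[of "flip c i"] mem_son_dirs_iff[of i] orphan_flip_iff[OF codeword, of i]
    by (auto simp: orphan_dirs_def father_dirs_def father_def)
  then show ?thesis
    by blast
qed

lemma sum_dirs:
  fixes f :: "'n \<Rightarrow> 'a::comm_monoid_add"
  shows "sum f UNIV = sum f (orphan_dirs C c) + sum f (father_dirs C c) + sum f (son_dirs C c)"
  unfolding UNIV_eq_dirs using disjoint_dirs[of C c] by (simp add: sum.union_disjoint)

lemma card_dirs:
  "CARD('n) = card (orphan_dirs C c) + card (father_dirs C c) + card (son_dirs C c)"
  using sum_dirs[of "\<lambda>_. 1 :: nat"] by simp

lemma share_eq_dirs:
  "share C c = 1 + real (card (orphan_dirs C c)) + real (card (son_dirs C c)) / 2
    + (\<Sum>j\<in>father_dirs C c. 1 / real (I_card C (flip c j)))"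
proof -
  have "(\<Sum>i\<in>orphan_dirs C c. 1 / real (I_card C (flip c i))) = (\<Sum>i\<in>orphan_dirs C c. 1)"
    by (intro sum.cong) (simp_all add: orphan_dirs_def orphan_def)
  moreover have "(\<Sum>i\<in>son_dirs C c. 1 / real (I_card C (flip c i))) = (\<Sum>i\<in>son_dirs C c. 1 / 2)"
    by (intro sum.cong) (simp_all add: son_dirs_def son_def)
  ultimately show ?thesis
    by (simp add: share_eq_sum_flip isolated sum_dirs)
qed

lemma orphan_dirs_eq_singleton:
  assumes "orphan C (flip c p)"
  shows "orphan_dirs C c = {p}"
  using assms by (auto simp: orphan_dirs_def dest: orphan_flip_unique[OF codeword])

lemma orphan_dir_notin_codeword_dirs:
  assumes "orphan C (flip c p)" "j \<noteq> p"
  shows "p \<notin> codeword_dirs C (flip c j)"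
proof
  assume "p \<in> codeword_dirs C (flip c j)"
  then have "flip (flip c p) j \<in> I_set C (flip c p)"
    by (simp add: codeword_dirs_def flip_commute[of c j p])
  then show False
    using orphan_flip_I_set[OF codeword assms(1)] assms(2) by simp
qed

lemma UN_codeword_dirs_eq:
  "(\<Union>j\<in>father_dirs C c. codeword_dirs C (flip c j)) = - orphan_dirs C c"
proof (intro equalityI subsetI)
  fix i assume "i \<in> (\<Union>j\<in>father_dirs C c. codeword_dirs C (flip c j))"
  then obtain j where j: "j \<in> father_dirs C c" "i \<in> codeword_dirs C (flip c j)"
    by blast
  show "i \<in> - orphan_dirs C c"
  proof
    assume i: "i \<in> orphan_dirs C c"
    then have "j \<noteq> i"
      using disjoint_dirs(1) j(1) by blast
    then show False
      using orphan_dir_notin_codeword_dirs i j(2) by (simp add: orphan_dirs_def)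
  qed
next
  fix i assume "i \<in> - orphan_dirs C c"
  then consider "i \<in> father_dirs C c" | "i \<in> son_dirs C c"
    using UNIV_eq_dirs by blast
  then show "i \<in> (\<Union>j\<in>father_dirs C c. codeword_dirs C (flip c j))"
  proof cases
    assume "i \<in> father_dirs C c"
    moreover have "i \<in> codeword_dirs C (flip c i)"
      by (simp add: codeword_dirs_def codeword)
    ultimately show ?thesis by blast
  next
    assume "i \<in> son_dirs C c"
    then have "I_card C (flip c i) = 2"
      by (simp add: mem_son_dirs_iff)
    then obtain j where "father C (flip c j)" "i \<in> codeword_dirs C (flip c j)"
      by (rule obtain_father_if_I_card_2)
    then show ?thesis
      by (auto simp: father_dirs_def)
  qed
qed

lemma CARD_le_sum_I_card:
  "CARD('n) \<le> card (orphan_dirs C c) + (\<Sum>j\<in>father_dirs C c. I_card C (flip c j))"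
proof -
  have "CARD('n) \<le> card (orphan_dirs C c) + card (- orphan_dirs C c)"
    using card_Un_le[of "orphan_dirs C c" "- orphan_dirs C c"] by simp
  also have "card (- orphan_dirs C c) \<le> (\<Sum>j\<in>father_dirs C c. card (codeword_dirs C (flip c j)))"
    unfolding UN_codeword_dirs_eq[symmetric] by (rule card_UN_le) simp
  finally show ?thesis
    by (simp add: I_card_flip)
qed

lemma share_le_if_card_father_dirs_neq_1:
  assumes "10 \<le> CARD('n)" and orphan: "card (orphan_dirs C c) = 1"
    and not_1: "card (father_dirs C c) \<noteq> 1"
  shows "share C c \<le> real CARD('n) / 2 + 1"
proof -
  have sum: "9 \<le> (\<Sum>j\<in>father_dirs C c. I_card C (flip c j))"
    using CARD_le_sum_I_card assms(1) orphan by simp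
  then have "father_dirs C c \<noteq> {}"
    by auto
  then have "0 < card (father_dirs C c)"
    by (simp add: card_gt_0_iff)
  then have "2 \<le> card (father_dirs C c)"
    using not_1 by simp
  moreover have "3 \<le> real (I_card C (flip c j))" if "j \<in> father_dirs C c" for j
    using that by (simp add: father_dirs_def father_def)
  moreover have "9 \<le> (\<Sum>j\<in>father_dirs C c. real (I_card C (flip c j)))"
    using sum by (simp flip: of_nat_sum)
  ultimately have "(\<Sum>j\<in>father_dirs C c. 1 / real (I_card C (flip c j)))
      \<le> (real (card (father_dirs C c)) - 1) / 2"
    by (rule sum_inverse_le_half_card)
  then show ?thesis
    using orphan by (simp add: share_eq_dirs card_dirs field_simps)
qed

lemma special_if_card_father_dirs:
  assumes "card (orphan_dirs C c) = 1" "card (father_dirs C c) = 1"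
  shows "special_codeword C c"
proof -
  have "card (son_dirs C c) = CARD('n) - 2"
    using assms card_dirs by linarith
  then show ?thesis
    using assms(1) codeword isolated by (simp add: special_codeword_iff_dirs)
qed

end

subsection \<open>Special codewords and special fathers\<close>

locale special_codeword_of_code = locating_dominating_code C for C :: "'n::finite bword set" +
  fixes c :: "'n bword"
  assumes special: "special_codeword C c"
begin

sublocale isolated_codeword C c
  using special by unfold_locales (simp_all add: special_codeword_def)

lemma card_special_dirs:
  "card (orphan_dirs C c) = 1" "card (son_dirs C c) = CARD('n) - 2"
  using special by (simp_all add: special_codeword_iff_dirs)

lemma father_dirs_eq_singleton:
  assumes "father C (flip c j)"
  shows "father_dirs C c = {j}"
proof -
  have "card (father_dirs C c) \<le> 1"
    using card_special_dirs card_dirs by linarith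
  then show ?thesis
    using assms by (intro card_seteq[symmetric]) (simp_all add: father_dirs_def)
qed

lemma obtain_father:
  assumes "2 \<le> CARD('n)"
  obtains j where "father C (flip c j)"
proof -
  have "card (father_dirs C c) = 1"
    using card_special_dirs card_dirs assms by linarith
  then show thesis
    using that by (auto simp: father_dirs_def card_1_singleton_iff)
qed

lemma father_flip_unique: "father C (flip c i) \<Longrightarrow> father C (flip c j) \<Longrightarrow> i = j"
  using father_dirs_eq_singleton by blast

lemma share_special:
  assumes "father C (flip c j)"
  shows "share C c = real CARD('n) / 2 + 1 + 1 / real (I_card C (flip c j))"
  using card_special_dirs(1)
  by (simp add: share_eq_dirs card_dirs father_dirs_eq_singleton[OF assms] field_simps)

lemma codeword_dirs_fatherE:
  assumes "father C (flip c j)"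
  obtains p where "codeword_dirs C (flip c j) = - {p}"
  using card_special_dirs(1) UN_codeword_dirs_eq that
  by (auto simp: father_dirs_eq_singleton[OF assms] card_1_singleton_iff)

lemma mem_C'_father:
  assumes "father C (flip c j)"
  shows "c \<in> C' C (flip c j)"
proof (rule mem_C'_flipI[OF codeword])
  show "\<not> special_father C c"
    by (simp add: special_father_def father_def isolated)
  show "special_father C (flip c k) \<longleftrightarrow> k = j" for k
    using assms father_flip_unique special by (auto simp: special_father_flip_iff)
qed

end

context locating_dominating_code
begin

lemma share_le_if_not_special:
  assumes "10 \<le> CARD('n)" "c \<in> C" "\<not> special_codeword C c"
  shows "share C c \<le> real CARD('n) / 2 + 1"
proof (cases "I_set C c = {c} \<and> (\<exists>i. orphan C (flip c i))")
  case True
  then obtain i where "orphan C (flip c i)" by blast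
  interpret isolated_codeword C c
    using assms True by unfold_locales simp_all
  have "card (orphan_dirs C c) = 1"
    using orphan_dirs_eq_singleton \<open>orphan C (flip c i)\<close> by simp
  then show ?thesis
    using share_le_if_card_father_dirs_neq_1 special_if_card_father_dirs assms by blast
next
  case False
  then show ?thesis
    using share_le_if_not_isolated share_le_if_no_orphan assms(2) by blast
qed

lemma special_codeword_mem_C'E:
  assumes "2 \<le> CARD('n)" "special_codeword C c"
  obtains u where "special_father C u" "c \<in> C' C u"
proof -
  interpret special_codeword_of_code C c
    using assms(2) by unfold_locales
  obtain j where "father C (flip c j)"
    using assms(1) by (rule obtain_father)
  then show thesis
    using that mem_C'_father special special_father_flip_iff by blast
qed

lemma special_father_codeword_dirsE:
  assumes "special_father C u"
  obtains p where "u \<notin> C" "codeword_dirs C u = - {p}"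
proof -
  obtain i where i: "special_codeword C (flip u i)"
    using assms by (rule special_father_codewordE)
  interpret special_codeword_of_code C "flip u i"
    by unfold_locales (fact i)
  have "father C (flip (flip u i) i)"
    using assms by (simp add: special_father_def)
  then show thesis
    using that flip_notin[of i] codeword_dirs_fatherE[of i] by auto
qed

lemma share_le_on_C':
  assumes "10 \<le> CARD('n)" "special_father C u" "a \<in> C' C u"
  shows "share C a \<le> real CARD('n) / 2 + 1 + 1 / real (I_card C u)"
proof (cases "special_codeword C a")
  case True
  then interpret special_codeword_of_code C a
    by unfold_locales
  have "u \<noteq> a"
    using assms(2) codeword by (auto elim: special_father_codeword_dirsE)
  then obtain i where i: "u = flip a i"
    using assms(3) by (auto simp: C'_def closed_nbhd_eq_insert_flip)
  then show ?thesis
    using share_special[of i] assms(2) by (simp add: special_father_def)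
next
  case False
  then have "share C a \<le> real CARD('n) / 2 + 1"
    using share_le_if_not_special assms by (simp add: C'_def I_set_def)
  then show ?thesis
    by (simp add: add_increasing2)
qed

end

locale compensating_codeword = locating_dominating_code C for C :: "'n::finite bword set" +
  fixes u :: "'n bword" and p i :: 'n
  assumes special_father: "special_father C u"
    and codeword_dirs_u: "codeword_dirs C u = - {p}"
    and covers_hole: "flip (flip u i) p \<in> C"
begin

abbreviation a :: "'n bword" where
  "a \<equiv> flip u i"

lemma flip_u_mem_code_iff: "flip u k \<in> C \<longleftrightarrow> k \<noteq> p"
  using codeword_dirs_u by (auto simp: codeword_dirs_def)

lemma a_mem_code: "a \<in> C"
  using covers_hole special_father by (auto simp: flip_u_mem_code_iff elim: special_father_codeword_dirsE)

lemma I_card_flip_a_ge_2: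
  assumes "k \<noteq> i"
  shows "2 \<le> I_card C (flip a k)"
proof (cases "k = p")
  case True
  then show ?thesis
    using covers_hole a_mem_code by (intro I_card_ge_2[of a _ _ "flip a p"]) simp_all
next
  case False
  then show ?thesis
    using a_mem_code assms by (intro I_card_ge_2[of a _ _ "flip u k"]) (simp_all add: flip_u_mem_code_iff)
qed

lemma share_a_le: "share C a \<le> real CARD('n) / 2 + 1 / real (I_card C u)"
proof -
  have "2 \<le> I_card C a"
    using covers_hole a_mem_code by (intro I_card_ge_2[of a _ _ "flip a p"]) simp_all
  then have "1 / real (I_card C a) \<le> 1 / 2"
    by (rule inverse_le_half)
  moreover have "share C a \<le>
      1 / real (I_card C a) + 1 / real (I_card C (flip a i)) + (real CARD('n) - 1) / 2"
    by (intro share_le_if_other_I_cards_ge_2 I_card_flip_a_ge_2)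
  ultimately show ?thesis
    by (simp add: diff_divide_distrib)
qed

lemma father_flip_a:
  assumes "l \<noteq> p" "k \<noteq> i" "k \<noteq> l" "flip (flip a l) k \<in> C"
  shows "father C (flip a l)"
proof (cases "l = i")
  case True
  then show ?thesis
    using special_father by (simp add: special_father_def)
next
  case False
  have "flip (flip a l) k \<noteq> flip u l"
    using assms(2) by (simp add: flip_commute[of u i l])
  then show ?thesis
    using False assms a_mem_code
    by (intro fatherI[of a "flip u l" "flip (flip a l) k"]) (auto simp: flip_u_mem_code_iff)
qed

text \<open>
  A special codeword \<open>z\<close> around a further special father \<open>flip a k\<close> would have a second father, the
  other common neighbour \<open>flip a l\<close> of \<open>a\<close> and \<open>z\<close>.
\<close>

lemma special_father_flip_a_iff: "special_father C (flip a k) \<longleftrightarrow> k = i"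
proof
  assume special_father_flip: "special_father C (flip a k)"
  then obtain l where l: "special_codeword C (flip (flip a k) l)"
    by (rule special_father_codewordE)
  define z where "z = flip (flip a k) l"
  interpret special_codeword_of_code C z
    using l by unfold_locales (simp add: z_def)
  have flip_z: "flip z l = flip a k" "flip z k = flip a l"
    by (simp_all add: z_def flip_commute[of _ l k])
  show "k = i"
  proof (rule ccontr)
    assume "k \<noteq> i"
    have "l \<noteq> p"
      using covers_hole flip_notin[of k] flip_z by auto
    moreover have "k \<noteq> l"
      using covers_hole flip_notin[of p] by (auto simp: z_def)
    ultimately have "father C (flip a l)"
      using \<open>k \<noteq> i\<close> codeword by (intro father_flip_a) (simp_all add: z_def flip_commute[of a k l])
    then have "k = l"
      using father_flip_unique[of k l] special_father_flip flip_z
      by (simp add: special_father_def)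
    then show False
      using \<open>k \<noteq> l\<close> by contradiction
  qed
qed (simp add: special_father)

lemma a_mem_C': "a \<in> C' C u"
proof -
  have "\<not> special_father C a"
    using a_mem_code by (auto elim: special_father_codeword_dirsE)
  then show ?thesis
    using mem_C'_flipI[of a C i] a_mem_code special_father_flip_a_iff by simp
qed

end

context locating_dominating_code
begin

lemma obtain_compensating_codeword:
  assumes "special_father C u"
  obtains a where "a \<in> C' C u" "share C a \<le> real CARD('n) / 2 + 1 / real (I_card C u)"
proof -
  obtain p where p: "codeword_dirs C u = - {p}"
    using assms by (rule special_father_codeword_dirsE)
  then have "flip u p \<notin> C"
    by (auto simp: codeword_dirs_def)
  then obtain i where "flip (flip u p) i \<in> C"
    using I_set_nonempty[of "flip u p"] by (auto simp: I_set_eq codeword_dirs_def)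
  then interpret compensating_codeword C u p i
    using assms p by unfold_locales (simp_all add: flip_commute[of u i p])
  show thesis
    using that a_mem_C' share_a_le by blast
qed

lemma mean_share_C'_le:
  assumes "10 \<le> CARD('n)" "special_father C u"
  shows "(\<Sum>a\<in>C' C u. share C a) / real (card (C' C u)) \<le> real CARD('n) / 2 + 1"
proof -
  obtain b where b: "b \<in> C' C u" "share C b \<le> real CARD('n) / 2 + 1 / real (I_card C u)"
    using assms(2) by (rule obtain_compensating_codeword)
  have "card (C' C u) \<le> I_card C u"
    by (intro card_mono) (auto simp: C'_def)
  then have "real (card (C' C u)) * (1 / real (I_card C u)) \<le> 1"
    using I_card_pos[of u] by simp
  then show ?thesis
    using b share_le_on_C'[OF assms] by (intro mean_le_if_compensated[where b = b]) auto
qed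

end

theorem theorem5:
  fixes C :: "'n::finite bword set" and c :: "'n bword"
  assumes "CARD('n) \<ge> 10"
    and "locating_dominating C"
    and "c \<in> C"
  shows "share_rule1 C c \<le> real CARD('n) / 2 + 1"
proof -
  interpret locating_dominating_code C
    using assms(2) by unfold_locales
  show ?thesis
  proof (cases "\<exists>u. special_father C u \<and> c \<in> C' C u")
    case True
    then show ?thesis
      using share_rule1_average mean_share_C'_le[OF assms(1)] by metis
  next
    case False
    moreover have "2 \<le> CARD('n)"
      using assms(1) by simp
    ultimately have "\<not> special_codeword C c"
      using special_codeword_mem_C'E by metis
    then have "share C c \<le> real CARD('n) / 2 + 1"
      using assms(1,3) by (intro share_le_if_not_special)
    moreover have "share_rule1 C c = share C c"
      using False by (intro share_rule1_unchanged) blast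
    ultimately show ?thesis
      by simp
  qed
qed

end
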